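(* For every $s'>0$ and every $s\in(0,s')$ there exists a constant $C_{s',s}>0$ such that, for every $h>0$ and every $v\in H^{s'}(\mathbb R)$, $$\|\mathcal T_hv\|_{\dot B^s_h}\le C_{s',s}\,\|v\|_{H^{s'}(\mathbb R)}.$$
   Context: Let $h>0$. For a sequence $v=(v_n)_{n\in\mathbb Z}$ put $\|v\|_{\ell^2_h}^2:=h\sum_{n\in\mathbb Z}|v_n|^2$; $\ell^2_h$ is the set of sequences with finite norm. The discrete Fourier transform of $v\in\ell^2_h$ is $\hat v(\xi)=\frac{h}{\sqrt{2\pi}}\sum_{n\in\mathbb Z}e^{-i\xi nh}v_n$, $\xi\in[-\frac\pi h,\frac\pi h]$ (an isometry from $\ell^2_h$ onto $L^2([-\frac\pi h,\frac\pi h])$), with inverse $(\mathcal F^{-1}g)_n=\frac1{\sqrt{2\pi}}\int_{-\pi/h}^{\pi/h}e^{i\xi nh}g(\xi)\,d\xi$. Dyadic decomposition: for $j\in\mathbb Z$ let $F_h(j):=\{\xi\in[-\frac\pi h,\frac\pi h]:\ |\frac{\sin(\xi h)}{h}|\in[\frac34 2^j,\frac43 2^{j+1}]\}$. Fix a family of measurable functions $\varphi_j:[-\frac\pi h,\frac\pi h]\to[0,1]$, $j\in\mathbb Z$ (depending on $h$), with $\mathrm{supp}(\varphi_j)\subseteq F_h(j)$ for all $j$ and $\sum_{j\in\mathbb Z}\varphi_j(\xi)=1$ for all $\xi\in[-\frac\pi h,\frac\pi h]$ with $\sin(\xi h)\ne0$. The localization operators are $\delta_h^jv:=\mathcal F^{-1}(\hat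 v\,\varphi_j)$ for $v\in\ell^2_h$, and the discrete Besov norm, for $s\in\mathbb R$, is $\|v\|_{\dot B^s_h}:=\sum_{j\in\mathbb Z}2^{js}\|\delta_h^jv\|_{\ell^2_h}$. Truncation operator: $\mathcal T_h:L^2(\mathbb R)\to\ell^2_h$, $(\mathcal T_hv)_n=\frac1{\sqrt{2\pi}}\int_{-\pi/h}^{\pi/h}e^{i\xi nh}\hat v(\xi)\,d\xi$, where here $\hat v$ is the (unitary) Fourier transform of $v\in L^2(\mathbb R)$, $\hat v(\xi)=\frac1{\sqrt{2\pi}}\int_{\mathbb R}e^{-i\xi x}v(x)\,dx$. $H^{s'}(\mathbb R)$ is the usual Sobolev space. *)

theory Defs
  imports "HOL-Analysis.Analysis"
begin

definition L2_space :: "'a measure \<Rightarrow> ('a \<Rightarrow> complex) set" where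
  "L2_space M = {f \<in> borel_measurable M. integrable M (\<lambda>x. (cmod (f x))\<^sup>2)}"

definition L2_norm :: "'a measure \<Rightarrow> ('a \<Rightarrow> complex) \<Rightarrow> real" where
  "L2_norm M f = sqrt (LINT x|M. (cmod (f x))\<^sup>2)"

(* The nonnegative integral is infinite where the Bochner integral would default to 0, so
   convergence cannot hold merely because the differences are not square integrable. *)
definition L2_tendsto ::
  "'a measure \<Rightarrow> ('i \<Rightarrow> 'a \<Rightarrow> complex) \<Rightarrow> ('a \<Rightarrow> complex) \<Rightarrow> 'i filter \<Rightarrow> bool" where
  "L2_tendsto M f g F \<longleftrightarrow>
     ((\<lambda>i. \<integral>\<^sup>+x. ennreal ((cmod (f i x - g x))\<^sup>2) \<partial>M) \<longlongrightarrow> 0) F"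

subsection \<open>Fourier transform on the line and Sobolev spaces\<close>

(* For v in L2 the Fourier integral need not converge absolutely; the transform is the
   L2-limit of the integrals over [-R,R] (Plancherel).  The limit is unique up to a null set,
   and everything below is insensitive to the choice of representative. *)
definition is_fourier_L2 :: "(real \<Rightarrow> complex) \<Rightarrow> (real \<Rightarrow> complex) \<Rightarrow> bool" where
  "is_fourier_L2 v g \<longleftrightarrow>
     g \<in> L2_space lebesgue \<and>
     L2_tendsto lebesgue
       (\<lambda>R \<xi>. of_real (1 / sqrt (2 * pi)) *
               (LINT x|lebesgue_on {-R..R}. exp (- \<i> * of_real (\<xi> * x)) * v x))
       g at_top"

definition fourier_L2 :: "(real \<Rightarrow> complex) \<Rightarrow> real \<Rightarrow> complex" where
  "fourier_L2 v = (SOME g. is_fourier_L2 v g)"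

definition sobolev_weighted :: "real \<Rightarrow> (real \<Rightarrow> complex) \<Rightarrow> real \<Rightarrow> complex" where
  "sobolev_weighted s v = (\<lambda>\<xi>. of_real ((1 + \<xi>\<^sup>2) powr (s / 2)) * fourier_L2 v \<xi>)"

definition sobolev_space :: "real \<Rightarrow> (real \<Rightarrow> complex) set" where
  "sobolev_space s = {v \<in> L2_space lebesgue. sobolev_weighted s v \<in> L2_space lebesgue}"

definition sobolev_norm :: "real \<Rightarrow> (real \<Rightarrow> complex) \<Rightarrow> real" where
  "sobolev_norm s v = L2_norm lebesgue (sobolev_weighted s v)"

subsection \<open>Sequences on the grid of mesh size h\<close>

definition l2h_space :: "(int \<Rightarrow> complex) set" where
  "l2h_space = {v. (\<lambda>n. (cmod (v n))\<^sup>2) summable_on UNIV}"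

definition l2h_norm :: "real \<Rightarrow> (int \<Rightarrow> complex) \<Rightarrow> ennreal" where
  "l2h_norm h v =
     (if v \<in> l2h_space then ennreal (sqrt (h * (\<Sum>\<^sub>\<infinity>n. (cmod (v n))\<^sup>2))) else \<infinity>)"

definition freq_interval :: "real \<Rightarrow> real set" where
  "freq_interval h = {- pi / h .. pi / h}"

(* The defining series of the discrete Fourier transform of a square-summable sequence
   converges (unconditionally) in L2 of the frequency interval; again the limit is unique up
   to a null set. *)
definition is_dft :: "real \<Rightarrow> (int \<Rightarrow> complex) \<Rightarrow> (real \<Rightarrow> complex) \<Rightarrow> bool" where
  "is_dft h v g \<longleftrightarrow>
     g \<in> L2_space (lebesgue_on (freq_interval h)) \<and>
     L2_tendsto (lebesgue_on (freq_interval h))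
       (\<lambda>N \<xi>. of_real (h / sqrt (2 * pi)) *
               (\<Sum>n\<in>N. exp (- \<i> * of_real (\<xi> * of_int n * h)) * v n))
       g (finite_subsets_at_top UNIV)"

definition dft :: "real \<Rightarrow> (int \<Rightarrow> complex) \<Rightarrow> real \<Rightarrow> complex" where
  "dft h v = (SOME g. is_dft h v g)"

definition inv_dft :: "real \<Rightarrow> (real \<Rightarrow> complex) \<Rightarrow> int \<Rightarrow> complex" where
  "inv_dft h g n =
     of_real (1 / sqrt (2 * pi)) *
     (LINT \<xi>|lebesgue_on (freq_interval h). exp (\<i> * of_real (\<xi> * of_int n * h)) * g \<xi>)"

definition truncation :: "real \<Rightarrow> (real \<Rightarrow> complex) \<Rightarrow> int \<Rightarrow> complex" where
  "truncation h v = inv_dft h (fourier_L2 v)"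

subsection \<open>Dyadic decomposition and discrete Besov norms\<close>

definition dyadic_shell :: "real \<Rightarrow> int \<Rightarrow> real set" where
  "dyadic_shell h j =
     {\<xi> \<in> freq_interval h.
        \<bar>sin (\<xi> * h) / h\<bar> \<in> {3/4 * 2 powi j .. 4/3 * 2 powi (j + 1)}}"

(* The values of phi outside the frequency interval are irrelevant. *)
definition dyadic_partition :: "real \<Rightarrow> (int \<Rightarrow> real \<Rightarrow> real) \<Rightarrow> bool" where
  "dyadic_partition h \<phi> \<longleftrightarrow>
     (\<forall>j. \<phi> j \<in> borel_measurable (lebesgue_on (freq_interval h))) \<and>
     (\<forall>j. \<forall>\<xi>\<in>freq_interval h. \<phi> j \<xi> \<in> {0..1}) \<and>
     (\<forall>j. closure {\<xi> \<in> freq_interval h. \<phi> j \<xi> \<noteq> 0} \<subseteq> dyadic_shell h j) \<and>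
     (\<forall>\<xi>\<in>freq_interval h. sin (\<xi> * h) \<noteq> 0 \<longrightarrow> ((\<lambda>j. \<phi> j \<xi>) has_sum 1) UNIV)"

definition localization ::
  "real \<Rightarrow> (int \<Rightarrow> real \<Rightarrow> real) \<Rightarrow> int \<Rightarrow> (int \<Rightarrow> complex) \<Rightarrow> int \<Rightarrow> complex" where
  "localization h \<phi> j v = inv_dft h (\<lambda>\<xi>. dft h v \<xi> * of_real (\<phi> j \<xi>))"

definition besov_norm ::
  "real \<Rightarrow> (int \<Rightarrow> real \<Rightarrow> real) \<Rightarrow> real \<Rightarrow> (int \<Rightarrow> complex) \<Rightarrow> ennreal" where
  "besov_norm h \<phi> s v =
     (\<Sum>\<^sub>\<infinity>j. ennreal (2 powr (of_int j * s)) * l2h_norm h (localization h \<phi> j v))"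

end

theory Submission
  imports Defs
begin

text \<open>
  On the shell with index \<open>j\<close> we have \<open>\<bar>\<xi>\<bar> \<ge> \<bar>sin (\<xi> h)\<bar> / h \<ge> 3/4 \<cdot> 2\<^sup>j\<close>, so there the Sobolev weight is at
  least \<open>(3/4 \<cdot> 2\<^sup>j) powr s'\<close> (used for \<open>j \<ge> 0\<close>) and at least \<open>1\<close> (used for \<open>j < 0\<close>).  By Bessel's
  inequality the localized pieces inherit this decay, and the Besov series is dominated by two
  geometric series, with ratios \<open>2 powr (- s)\<close> and \<open>2 powr (s - s')\<close>.  What needs work is that the
  discrete Fourier transform of the truncation is the restricted transform of \<open>v\<close>; this is the
  completeness of the trigonometric system, obtained from the Stone-Weierstrass theorem on the unit
  circle.  Plancherel's theorem on the line is not needed: membership in the Sobolev space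
  already makes the chosen representative of the transform a square integrable function.
\<close>

section \<open>Square-integrable functions and uniqueness of limits in the mean\<close>

lemma cmod_add_squared_le: "(cmod (a + b))\<^sup>2 \<le> 2 * (cmod a)\<^sup>2 + 2 * (cmod b)\<^sup>2"
proof -
  have "(cmod (a + b))\<^sup>2 \<le> (cmod a + cmod b)\<^sup>2"
    by (simp add: norm_triangle_ineq power_mono)
  also have "\<dots> \<le> 2 * (cmod a)\<^sup>2 + 2 * (cmod b)\<^sup>2"
    using zero_le_power2[of "cmod a - cmod b"] by (simp add: power2_eq_square algebra_simps)
  finally show ?thesis .
qed

lemma L2_spaceD:
  assumes "f \<in> L2_space M"
  shows "f \<in> borel_measurable M" "integrable M (\<lambda>x. (cmod (f x))\<^sup>2)"
  using assms by (auto simp: L2_space_def)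

lemma L2_space_bound:
  assumes "f \<in> borel_measurable M" "integrable M u" "\<And>x. x \<in> space M \<Longrightarrow> (cmod (f x))\<^sup>2 \<le> u x"
  shows "f \<in> L2_space M"
  unfolding L2_space_def
  using assms by (auto intro!: Bochner_Integration.integrable_bound[OF assms(2)]) 
    (smt (verit) AE_I2)

lemma L2_space_add:
  assumes f: "f \<in> L2_space M" and g: "g \<in> L2_space M"
  shows "(\<lambda>x. f x + g x) \<in> L2_space M"
proof (rule L2_space_bound[where u = "\<lambda>x. 2 * (cmod (f x))\<^sup>2 + 2 * (cmod (g x))\<^sup>2"])
  show "(\<lambda>x. f x + g x) \<in> borel_measurable M"
    using L2_spaceD(1)[OF f] L2_spaceD(1)[OF g] by (rule borel_measurable_add)
  show "integrable M (\<lambda>x. 2 * (cmod (f x))\<^sup>2 + 2 * (cmod (g x))\<^sup>2)"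
    by (intro Bochner_Integration.integrable_add integrable_mult_right L2_spaceD(2) f g)
qed (rule cmod_add_squared_le)

lemma L2_space_cmult:
  assumes f: "f \<in> L2_space M"
  shows "(\<lambda>x. c * f x) \<in> L2_space M"
  using f by (auto simp: L2_space_def norm_mult power_mult_distrib)

lemma L2_space_zero: "(\<lambda>x. 0) \<in> L2_space M"
  by (simp add: L2_space_def)

lemma L2_space_diff:
  assumes f: "f \<in> L2_space M" and g: "g \<in> L2_space M"
  shows "(\<lambda>x. f x - g x) \<in> L2_space M"
  using L2_space_add[OF f L2_space_cmult[OF g, of "-1"]] by simp

lemma L2_space_sum:
  assumes "\<And>i. i \<in> I \<Longrightarrow> f i \<in> L2_space M"
  shows "(\<lambda>x. \<Sum>i\<in>I. f i x) \<in> L2_space M"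
  using assms
  by (induction I rule: infinite_finite_induct) (auto simp: L2_space_zero intro: L2_space_add)

lemma cnj_borel: "cnj \<in> borel_measurable borel"
  by (intro borel_measurable_continuous_onI continuous_intros)

lemma L2_integrable_product:
  assumes f: "f \<in> L2_space M" and g: "g \<in> L2_space M"
  shows "integrable M (\<lambda>x. f x * cnj (g x))"
proof (rule Bochner_Integration.integrable_bound)
  show "integrable M (\<lambda>x. (cmod (f x))\<^sup>2 + (cmod (g x))\<^sup>2)"
    using f g by (auto dest: L2_spaceD)
  show "(\<lambda>x. f x * cnj (g x)) \<in> borel_measurable M"
    using L2_spaceD(1)[OF f] measurable_compose[OF L2_spaceD(1)[OF g] cnj_borel]
    by (rule borel_measurable_times)
  have "a * b \<le> a\<^sup>2 + b\<^sup>2" if "a \<ge> 0" "b \<ge> 0" for a b :: real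
    using zero_le_power2[of "a - b"] mult_nonneg_nonneg[OF that] unfolding power2_diff by linarith
  then show "AE x in M. norm (f x * cnj (g x)) \<le> norm ((cmod (f x))\<^sup>2 + (cmod (g x))\<^sup>2)"
    by (intro AE_I2) (simp add: norm_mult)
qed

lemma L2_integral_square:
  "complex_of_real (LINT x|M. (cmod (f x))\<^sup>2) = (LINT x|M. f x * cnj (f x))"
  unfolding integral_complex_of_real[symmetric] complex_norm_square ..

lemma L2_integral_add_le:
  assumes f: "f \<in> L2_space M" and g: "g \<in> L2_space M"
  shows "(LINT x|M. (cmod (f x + g x))\<^sup>2)
       \<le> 2 * (LINT x|M. (cmod (f x))\<^sup>2) + 2 * (LINT x|M. (cmod (g x))\<^sup>2)"
proof -
  have "(LINT x|M. (cmod (f x + g x))\<^sup>2) \<le> (LINT x|M. 2 * (cmod (f x))\<^sup>2 + 2 * (cmod (g x))\<^sup>2)"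
    using L2_spaceD(2)[OF L2_space_add[OF f g]] L2_spaceD(2)[OF f] L2_spaceD(2)[OF g]
    by (intro integral_mono) (auto intro: cmod_add_squared_le)
  also have "\<dots> = 2 * (LINT x|M. (cmod (f x))\<^sup>2) + 2 * (LINT x|M. (cmod (g x))\<^sup>2)"
    using L2_spaceD(2)[OF f] L2_spaceD(2)[OF g] by simp
  finally show ?thesis .
qed

text \<open>Inserting \<open>u i\<close> bounds the fixed squared distance of \<open>f\<close> and
  \<open>g\<close> by a quantity that tends to 0. This is what turns the choice by
  \<open>SOME\<close> in \<open>dft\<close> into a function determined up to a null set.\<close>

lemma L2_tendsto_unique:
  assumes f: "f \<in> borel_measurable M" and g: "g \<in> borel_measurable M"
    and u: "\<And>i. u i \<in> borel_measurable M"
    and F: "F \<noteq> bot" and uf: "L2_tendsto M u f F" and ug: "L2_tendsto M u g F"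
  shows "AE x in M. f x = g x"
proof -
  note [measurable] = f g u
  let ?d = "\<lambda>p q. \<integral>\<^sup>+x. ennreal ((cmod (p x - q x))\<^sup>2) \<partial>M"
  have "?d f g \<le> 2 * ?d (u i) f + 2 * ?d (u i) g" for i
  proof -
    have le: "(cmod (f x - g x))\<^sup>2 \<le> 2 * (cmod (u i x - f x))\<^sup>2 + 2 * (cmod (u i x - g x))\<^sup>2" for x
      using cmod_add_squared_le[of "f x - u i x" "u i x - g x"] by (simp add: norm_minus_commute)
    have "?d f g \<le> (\<integral>\<^sup>+x. 2 * ennreal ((cmod (u i x - f x))\<^sup>2) + 2 * ennreal ((cmod (u i x - g x))\<^sup>2) \<partial>M)"
    proof (intro nn_integral_mono)
      fix x
      show "ennreal ((cmod (f x - g x))\<^sup>2)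
          \<le> 2 * ennreal ((cmod (u i x - f x))\<^sup>2) + 2 * ennreal ((cmod (u i x - g x))\<^sup>2)"
        using ennreal_leI[OF le[of x]] by (simp add: ennreal_plus ennreal_mult)
    qed
    also have "\<dots> = 2 * ?d (u i) f + 2 * ?d (u i) g"
      by (subst nn_integral_add) (auto simp: nn_integral_cmult)
    finally show ?thesis .
  qed
  moreover have "((\<lambda>i. 2 * ?d (u i) f + 2 * ?d (u i) g) \<longlongrightarrow> 2 * 0 + 2 * 0) F"
    using uf ug unfolding L2_tendsto_def by (intro tendsto_add ennreal_tendsto_cmult) auto
  ultimately have "?d f g \<le> 0"
    using tendsto_lowerbound[OF _ _ F, of _ 0 "?d f g"] by auto
  then have "AE x in M. ennreal ((cmod (f x - g x))\<^sup>2) = 0"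
    by (subst (asm) le_zero_eq, subst (asm) nn_integral_0_iff_AE) auto
  then show ?thesis
    by eventually_elim simp
qed

section \<open>Orthogonal systems: Bessel's inequality and Fourier series\<close>

locale orthogonal_system =
  fixes M :: "'a measure" and e :: "'i \<Rightarrow> 'a \<Rightarrow> complex" and K :: real
  assumes K_pos: "K > 0"
    and e_L2: "\<And>n. e n \<in> L2_space M"
    and orth: "\<And>m n. (LINT x|M. e m x * cnj (e n x)) = (if m = n then of_real K else 0)"
begin

text \<open>Left unnormalized: the expansion coefficient is \<open>coef g n / K\<close>. For the
  exponentials this makes \<open>inv_dft\<close> a multiple of \<open>coef\<close> by a factor
  independent of \<open>h\<close>.\<close>

definition coef :: "('a \<Rightarrow> complex) \<Rightarrow> 'i \<Rightarrow> complex" where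
  "coef g n = (LINT x|M. g x * cnj (e n x))"

lemma combination_L2: "(\<lambda>x. \<Sum>n\<in>N. c n * e n x) \<in> L2_space M"
  by (intro L2_space_sum L2_space_cmult e_L2)

text \<open>The square is expanded and then completed index by index: with
  \<open>a = coef g n\<close>, the cross terms and \<open>K * |c n|^2\<close> combine to
  \<open>K * |c n - a / K|^2 - |a|^2 / K\<close>. The coefficients \<open>c\<close> enter only
  through the middle term, so Bessel's inequality and best approximation can both be read
  off.\<close>

lemma integral_diff_combination:
  assumes g: "g \<in> L2_space M" and N: "finite N"
  shows "(LINT x|M. (cmod (g x - (\<Sum>n\<in>N. c n * e n x)))\<^sup>2)
       = (LINT x|M. (cmod (g x))\<^sup>2) + K * (\<Sum>n\<in>N. (cmod (c n - coef g n / K))\<^sup>2)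
         - (\<Sum>n\<in>N. (cmod (coef g n))\<^sup>2) / K"
proof -
  let ?p = "\<lambda>x. \<Sum>n\<in>N. c n * e n x"
  note p = combination_L2[of c N]
  have gp: "(LINT x|M. g x * cnj (?p x)) = (\<Sum>n\<in>N. cnj (c n) * coef g n)"
  proof -
    have "(LINT x|M. g x * cnj (?p x)) = (LINT x|M. (\<Sum>n\<in>N. cnj (c n) * (g x * cnj (e n x))))"
      by (simp add: sum_distrib_left mult_ac)
    also have "\<dots> = (\<Sum>n\<in>N. cnj (c n) * coef g n)"
      by (subst Bochner_Integration.integral_sum)
        (auto simp: coef_def intro!: L2_integrable_product g e_L2)
    finally show ?thesis .
  qed
  have pg: "(LINT x|M. ?p x * cnj (g x)) = (\<Sum>n\<in>N. c n * cnj (coef g n))"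
  proof -
    have "(LINT x|M. ?p x * cnj (g x)) = (LINT x|M. cnj (g x * cnj (?p x)))"
      by (simp add: mult.commute)
    also have "\<dots> = cnj (LINT x|M. g x * cnj (?p x))"
      using L2_integrable_product[OF g p] by (rule integral_bounded_linear[OF bounded_linear_cnj])
    also have "\<dots> = (\<Sum>n\<in>N. c n * cnj (coef g n))"
      unfolding gp by simp
    finally show ?thesis .
  qed
  have coef_p: "coef ?p n = c n * K" if n: "n \<in> N" for n
  proof -
    have "coef ?p n = (LINT x|M. (\<Sum>m\<in>N. c m * (e m x * cnj (e n x))))"
      unfolding coef_def by (simp add: sum_distrib_right mult.assoc)
    also have "\<dots> = (\<Sum>m\<in>N. c m * (if m = n then of_real K else 0))"
      by (subst Bochner_Integration.integral_sum)
        (auto simp: orth intro!: L2_integrable_product e_L2)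
    also have "\<dots> = (\<Sum>m\<in>N. if m = n then c m * of_real K else 0)"
      by (intro sum.cong) auto
    also have "\<dots> = c n * K"
      using n N by simp
    finally show ?thesis .
  qed
  have pp: "(LINT x|M. ?p x * cnj (?p x)) = (\<Sum>n\<in>N. c n * cnj (c n) * K)"
  proof -
    have "(LINT x|M. ?p x * cnj (?p x)) = (LINT x|M. (\<Sum>n\<in>N. cnj (c n) * (?p x * cnj (e n x))))"
      by (simp add: sum_distrib_left mult_ac)
    also have "\<dots> = (\<Sum>n\<in>N. cnj (c n) * coef ?p n)"
      by (subst Bochner_Integration.integral_sum)
        (auto simp: coef_def intro!: L2_integrable_product p e_L2)
    also have "\<dots> = (\<Sum>n\<in>N. c n * cnj (c n) * K)"
      by (intro sum.cong) (auto simp: coef_p)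
    finally show ?thesis .
  qed
  have "complex_of_real (LINT x|M. (cmod (g x - ?p x))\<^sup>2)
      = (LINT x|M. g x * cnj (g x) - g x * cnj (?p x) - ?p x * cnj (g x) + ?p x * cnj (?p x))"
    unfolding L2_integral_square by (intro Bochner_Integration.integral_cong refl) (simp only: complex_cnj_diff algebra_simps)
  also have "\<dots> = (LINT x|M. g x * cnj (g x)) - (\<Sum>n\<in>N. cnj (c n) * coef g n)
      - (\<Sum>n\<in>N. c n * cnj (coef g n)) + (\<Sum>n\<in>N. c n * cnj (c n) * K)"
    using L2_integrable_product[OF g g] L2_integrable_product[OF g p]
      L2_integrable_product[OF p g] L2_integrable_product[OF p p]
    unfolding gp[symmetric] pg[symmetric] pp[symmetric]
    by (simp only: Bochner_Integration.integral_diff Bochner_Integration.integral_add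
        Bochner_Integration.integrable_diff Bochner_Integration.integrable_add)
  also have "\<dots> = (LINT x|M. g x * cnj (g x)) + (\<Sum>n\<in>N. - cnj (c n) * coef g n
      - c n * cnj (coef g n) + c n * cnj (c n) * K)"
    by (simp add: sum.distrib sum_subtractf sum_negf)
  also have "(\<Sum>n\<in>N. - cnj (c n) * coef g n - c n * cnj (coef g n) + c n * cnj (c n) * K)
      = (\<Sum>n\<in>N. of_real (K * (cmod (c n - coef g n / K))\<^sup>2 - (cmod (coef g n))\<^sup>2 / K))"
  proof (intro sum.cong refl)
    fix n
    show "- cnj (c n) * coef g n - c n * cnj (coef g n) + c n * cnj (c n) * K
        = complex_of_real (K * (cmod (c n - coef g n / K))\<^sup>2 - (cmod (coef g n))\<^sup>2 / K)"
      using K_pos unfolding of_real_diff of_real_mult of_real_divide complex_norm_square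
      by (simp add: field_simps)
  qed
  also have "(LINT x|M. g x * cnj (g x)) + \<dots>
     = complex_of_real ((LINT x|M. (cmod (g x))\<^sup>2) + K * (\<Sum>n\<in>N. (cmod (c n - coef g n / K))\<^sup>2)
         - (\<Sum>n\<in>N. (cmod (coef g n))\<^sup>2) / K)"
    unfolding L2_integral_square[symmetric]
    by (simp add: sum_subtractf sum_distrib_left sum_divide_distrib)
  finally show ?thesis
    unfolding of_real_eq_iff .
qed

text \<open>The choice \<open>c n = coef g n / K\<close> makes the middle term of the identity
  vanish, and its left side is nonnegative.\<close>

lemma bessel:
  assumes g: "g \<in> L2_space M" and N: "finite N"
  shows "(\<Sum>n\<in>N. (cmod (coef g n))\<^sup>2) \<le> K * (LINT x|M. (cmod (g x))\<^sup>2)"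
proof -
  have "0 \<le> (LINT x|M. (cmod (g x - (\<Sum>n\<in>N. (coef g n / K) * e n x)))\<^sup>2)"
    by simp
  also have "\<dots> = (LINT x|M. (cmod (g x))\<^sup>2) - (\<Sum>n\<in>N. (cmod (coef g n))\<^sup>2) / K"
    by (subst integral_diff_combination[OF g N]) simp
  finally show ?thesis
    using K_pos by (simp add: field_simps)
qed

text \<open>The competitor may live on a smaller index set \<open>N'\<close>, because enlarging the
  index set only subtracts more in the identity. This monotonicity is what convergence along
  \<open>finite_subsets_at_top\<close> asks for.\<close>

lemma best_approximation:
  assumes g: "g \<in> L2_space M" and N: "finite N" and sub: "N' \<subseteq> N"
  shows "(LINT x|M. (cmod (g x - (\<Sum>n\<in>N. (coef g n / K) * e n x)))\<^sup>2)
       \<le> (LINT x|M. (cmod (g x - (\<Sum>n\<in>N'. c n * e n x)))\<^sup>2)"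
proof -
  let ?S = "\<lambda>N. \<Sum>n\<in>N. (cmod (coef g n))\<^sup>2"
  have "?S N' \<le> ?S N"
    using N sub by (intro sum_mono2) auto
  then have "?S N' / K \<le> ?S N / K"
    using K_pos by (intro divide_right_mono) auto
  moreover have "0 \<le> K * (\<Sum>n\<in>N'. (cmod (c n - coef g n / K))\<^sup>2)"
    using K_pos by (intro mult_nonneg_nonneg sum_nonneg) auto
  ultimately show ?thesis
    unfolding integral_diff_combination[OF g N]
      integral_diff_combination[OF g finite_subset[OF sub N]] by simp
qed

text \<open>Density supplies one good combination on some \<open>N'\<close>; by best approximation
  the Fourier partial sum is at least as good on every finite superset of \<open>N'\<close>.\<close>

lemma L2_tendsto_fourier_series:
  assumes g: "g \<in> L2_space M"
    and dense: "\<And>\<epsilon>. \<epsilon> > 0 \<Longrightarrow>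
      \<exists>N c. finite N \<and> (LINT x|M. (cmod (g x - (\<Sum>n\<in>N. c n * e n x)))\<^sup>2) < \<epsilon>"
  shows "L2_tendsto M (\<lambda>N x. \<Sum>n\<in>N. (coef g n / K) * e n x) g (finite_subsets_at_top UNIV)"
  unfolding L2_tendsto_def
proof (rule tendsto_zero_ennreal)
  fix r :: real assume "0 < r"
  from dense[OF this] obtain N' c where N': "finite N'"
    and less: "(LINT x|M. (cmod (g x - (\<Sum>n\<in>N'. c n * e n x)))\<^sup>2) < r"
    by auto
  show "\<forall>\<^sub>F N in finite_subsets_at_top UNIV.
      (\<integral>\<^sup>+x. ennreal ((cmod ((\<Sum>n\<in>N. (coef g n / K) * e n x) - g x))\<^sup>2) \<partial>M) < ennreal r"
    unfolding eventually_finite_subsets_at_top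
  proof (intro exI[of _ N'] conjI allI impI)
    fix N assume N: "finite N \<and> N' \<subseteq> N \<and> N \<subseteq> UNIV"
    \<comment> \<open>The difference lies in L2, so the nonnegative integral of
      \<open>L2_tendsto\<close> agrees with the Bochner integral of
      \<open>best_approximation\<close>.\<close>
    have "(\<integral>\<^sup>+x. ennreal ((cmod ((\<Sum>n\<in>N. (coef g n / K) * e n x) - g x))\<^sup>2) \<partial>M)
        = ennreal (LINT x|M. (cmod (g x - (\<Sum>n\<in>N. (coef g n / K) * e n x)))\<^sup>2)"
      by (subst norm_minus_commute,
          intro nn_integral_eq_integral L2_spaceD(2)[OF L2_space_diff[OF g combination_L2]]) auto
    also have "\<dots> < ennreal r"
      using best_approximation[OF g, of N N' c] N less \<open>0 < r\<close> by (intro ennreal_lessI) auto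
    finally show "(\<integral>\<^sup>+x. ennreal ((cmod ((\<Sum>n\<in>N. (coef g n / K) * e n x) - g x))\<^sup>2) \<partial>M) < ennreal r" .
  qed (use N' in auto)
qed

end

text \<open>The limit passage shared by the two approximations below: continuous approximants on the
  circle, and the removal of large values.\<close>

lemma L2_dominated_convergence:
  assumes g: "g \<in> borel_measurable M" and u: "\<And>k::nat. u k \<in> borel_measurable M"
    and lim: "AE x in M. (\<lambda>k. u k x) \<longlonglongrightarrow> g x"
    and w: "integrable M w"
    and bound: "\<And>k. AE x in M. (cmod (u k x - g x))\<^sup>2 \<le> w x"
  shows "(\<lambda>k. LINT x|M. (cmod (g x - u k x))\<^sup>2) \<longlonglongrightarrow> 0"
proof -
  note [measurable] = g u
  have "(\<lambda>k. LINT x|M. (cmod (g x - u k x))\<^sup>2) \<longlonglongrightarrow> (LINT x|M. 0)"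
  proof (rule integral_dominated_convergence[OF _ _ w])
    show "AE x in M. (\<lambda>k. (cmod (g x - u k x))\<^sup>2) \<longlonglongrightarrow> 0"
      using lim
    proof eventually_elim
      case (elim x)
      have "(\<lambda>k. (cmod (g x - u k x))\<^sup>2) \<longlonglongrightarrow> (cmod (g x - g x))\<^sup>2"
        by (intro tendsto_intros elim)
      then show ?case by simp
    qed
    show "AE x in M. norm ((cmod (g x - u k x))\<^sup>2) \<le> w x" for k
      using bound[of k] by eventually_elim (simp add: norm_minus_commute)
  qed measurable
  then show ?thesis by simp
qed

section \<open>Trigonometric polynomials and their uniform density\<close>

definition freq_exp :: "real \<Rightarrow> int \<Rightarrow> real \<Rightarrow> complex" where
  "freq_exp h n \<xi> = exp (- \<i> * of_real (\<xi> * of_int n * h))"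

lemma freq_exp_cis: "freq_exp h n \<xi> = cis (- (\<xi> * of_int n * h))"
  by (simp add: freq_exp_def cis_conv_exp)

lemma freq_exp_mult: "freq_exp h m \<xi> * freq_exp h n \<xi> = freq_exp h (m + n) \<xi>"
  by (simp add: freq_exp_cis cis_mult algebra_simps)

lemma cnj_freq_exp: "cnj (freq_exp h n \<xi>) = freq_exp h (- n) \<xi>"
  by (simp add: freq_exp_cis cis_cnj)

lemma freq_exp_0 [simp]: "freq_exp h 0 \<xi> = 1"
  by (simp add: freq_exp_def)

lemma continuous_on_freq_exp: "continuous_on A (freq_exp h n)"
  unfolding freq_exp_def[abs_def] by (intro continuous_intros)

definition trig_poly :: "real \<Rightarrow> (real \<Rightarrow> complex) \<Rightarrow> bool" where
  "trig_poly h p \<longleftrightarrow> (\<exists>N c. finite N \<and> p = (\<lambda>\<xi>. \<Sum>n\<in>N. c n * freq_exp h n \<xi>))"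

lemma trig_poly_monom: "trig_poly h (\<lambda>\<xi>. c * freq_exp h n \<xi>)"
  unfolding trig_poly_def by (intro exI[of _ "{n}"] exI[of _ "\<lambda>_. c"]) simp

lemma trig_poly_const: "trig_poly h (\<lambda>\<xi>. c)"
  using trig_poly_monom[of h c 0] by simp

lemma trig_poly_add:
  assumes "trig_poly h p" "trig_poly h q"
  shows "trig_poly h (\<lambda>\<xi>. p \<xi> + q \<xi>)"
proof -
  obtain N c where N: "finite N" and p: "p = (\<lambda>\<xi>. \<Sum>n\<in>N. c n * freq_exp h n \<xi>)"
    using assms(1) unfolding trig_poly_def by auto
  obtain N' d where N': "finite N'" and q: "q = (\<lambda>\<xi>. \<Sum>n\<in>N'. d n * freq_exp h n \<xi>)"
    using assms(2) unfolding trig_poly_def by auto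
  \<comment> \<open>Each coefficient family is replaced by zero off its own index set, since its
    values there are arbitrary.\<close>
  let ?c = "\<lambda>n. (if n \<in> N then c n else 0) + (if n \<in> N' then d n else 0)"
  have "p \<xi> + q \<xi> = (\<Sum>n\<in>N \<union> N'. ?c n * freq_exp h n \<xi>)" for \<xi>
  proof -
    have "p \<xi> = (\<Sum>n\<in>N \<union> N'. (if n \<in> N then c n else 0) * freq_exp h n \<xi>)"
      unfolding p using N N' by (intro sum.mono_neutral_cong_left) auto
    moreover have "q \<xi> = (\<Sum>n\<in>N \<union> N'. (if n \<in> N' then d n else 0) * freq_exp h n \<xi>)"
      unfolding q using N N' by (intro sum.mono_neutral_cong_left) auto
    ultimately show ?thesis
      by (simp only: sum.distrib distrib_right)
  qed
  then show ?thesis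
    unfolding trig_poly_def using N N' by (intro exI[of _ "N \<union> N'"] exI[of _ ?c]) auto
qed

lemma trig_poly_sum:
  assumes "\<And>i. i \<in> A \<Longrightarrow> trig_poly h (f i)"
  shows "trig_poly h (\<lambda>\<xi>. \<Sum>i\<in>A. f i \<xi>)"
  using assms
  by (induction A rule: infinite_finite_induct) (auto simp: trig_poly_const trig_poly_add)

lemma trig_poly_mult:
  assumes "trig_poly h p" "trig_poly h q"
  shows "trig_poly h (\<lambda>\<xi>. p \<xi> * q \<xi>)"
proof -
  obtain N c where N: "finite N" and p: "p = (\<lambda>\<xi>. \<Sum>n\<in>N. c n * freq_exp h n \<xi>)"
    using assms(1) unfolding trig_poly_def by auto
  obtain N' d where N': "finite N'" and q: "q = (\<lambda>\<xi>. \<Sum>n\<in>N'. d n * freq_exp h n \<xi>)"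
    using assms(2) unfolding trig_poly_def by auto
  have "(\<lambda>\<xi>. p \<xi> * q \<xi>) = (\<lambda>\<xi>. \<Sum>n\<in>N. \<Sum>m\<in>N'. (c n * d m) * freq_exp h (n + m) \<xi>)"
    unfolding p q sum_product freq_exp_mult[symmetric] by (simp add: mult_ac)
  then show ?thesis
    by (simp add: trig_poly_sum trig_poly_monom)
qed

lemma trig_poly_cos: "trig_poly h (\<lambda>\<xi>. of_real (cos (\<xi> * h)))"
proof -
  have "complex_of_real (cos (\<xi> * h)) = 1/2 * freq_exp h 1 \<xi> + 1/2 * freq_exp h (-1) \<xi>" for \<xi>
    by (simp add: freq_exp_cis complex_eq_iff)
  then show ?thesis
    by (simp only: trig_poly_add trig_poly_monom)
qed

lemma trig_poly_sin: "trig_poly h (\<lambda>\<xi>. of_real (sin (\<xi> * h)))"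
proof -
  have "complex_of_real (sin (\<xi> * h)) = \<i>/2 * freq_exp h 1 \<xi> + (-\<i>/2) * freq_exp h (-1) \<xi>" for \<xi>
    by (simp add: freq_exp_cis complex_eq_iff)
  then show ?thesis
    by (simp only: trig_poly_add trig_poly_monom)
qed

text \<open>Induction over the generation of polynomial functions: a real linear functional on the
  plane restricts on the unit circle to a combination of cosine and sine, and trigonometric
  polynomials are closed under sums and products.\<close>

lemma trig_poly_real_polynomial_function:
  assumes "real_polynomial_function q"
  shows "trig_poly h (\<lambda>\<xi>. of_real (q (cis (\<xi> * h))))"
  using assms
proof induction
  case (linear f)
  interpret f: bounded_linear f by fact
  have "f (cis t) = cos t * f 1 + sin t * f \<i>" for t
  proof -
    have "cis t = cos t *\<^sub>R 1 + sin t *\<^sub>R \<i>"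
      by (simp add: complex_eq_iff)
    then show ?thesis
      by (simp only: f.add f.scaleR real_scaleR_def)
  qed
  then have "complex_of_real (f (cis t)) = of_real (cos t) * of_real (f 1) + of_real (sin t) * of_real (f \<i>)" for t
    by simp
  then show ?case
    by (simp only: trig_poly_add trig_poly_mult trig_poly_cos trig_poly_sin trig_poly_const)
qed (simp_all add: trig_poly_const trig_poly_add trig_poly_mult)

text \<open>Stone-Weierstrass gives a polynomial in the two real coordinates of the circle; its real
  and imaginary parts pull back along \<open>cis (\<xi> * h)\<close> to trigonometric
  polynomials.\<close>

lemma trig_poly_uniformly_dense:
  assumes f: "continuous_on (sphere 0 1) f" and \<epsilon>: "\<epsilon> > 0"
  obtains p where "trig_poly h p" "\<And>\<xi>. cmod (f (cis (\<xi> * h)) - p \<xi>) < \<epsilon>"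
proof -
  obtain q :: "complex \<Rightarrow> complex" where q: "polynomial_function q"
    and fq: "\<forall>z\<in>sphere 0 1. norm (f z - q z) < \<epsilon>"
    using Stone_Weierstrass_polynomial_function[OF compact_sphere f \<epsilon>] by auto
  have Re: "real_polynomial_function (Re \<circ> q)" and Im: "real_polynomial_function (Im \<circ> q)"
    using q bounded_linear_Re bounded_linear_Im unfolding polynomial_function_def by blast+
  have eq: "q z = of_real ((Re \<circ> q) z) + \<i> * of_real ((Im \<circ> q) z)" for z
    by (simp add: complex_eq_iff)
  have "trig_poly h (\<lambda>\<xi>. of_real ((Re \<circ> q) (cis (\<xi> * h))) + \<i> * of_real ((Im \<circ> q) (cis (\<xi> * h))))"
    by (intro trig_poly_add trig_poly_mult trig_poly_const trig_poly_real_polynomial_function Re Im)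
  then have "trig_poly h (\<lambda>\<xi>. q (cis (\<xi> * h)))"
    unfolding eq[symmetric] .
  then show thesis
    by (rule that) (use fq in simp)
qed

section \<open>The exponentials as an orthogonal system on the frequency interval\<close>

lemma freq_interval_lmeasurable [simp, intro]: "freq_interval h \<in> lmeasurable"
  by (simp add: freq_interval_def)

lemma freq_interval_sets [simp, intro]: "freq_interval h \<in> sets lebesgue"
  by (simp add: fmeasurableD)

lemma L2_space_bounded:
  assumes "finite_measure M" "f \<in> borel_measurable M" "\<And>x. x \<in> space M \<Longrightarrow> cmod (f x) \<le> B"
  shows "f \<in> L2_space M"
proof (rule L2_space_bound[where u = "\<lambda>x. B\<^sup>2"])
  show "integrable M (\<lambda>x. B\<^sup>2)"
    using assms(1) by (simp add: finite_measure.integrable_const)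
qed (use assms in \<open>auto intro: power_mono\<close>)

lemma continuous_L2_space_freq_interval:
  assumes f: "continuous_on (freq_interval h) f"
  shows "f \<in> L2_space (lebesgue_on (freq_interval h))"
proof -
  have "bounded (f ` freq_interval h)"
    using f by (intro compact_imp_bounded compact_continuous_image) (auto simp: freq_interval_def)
  then obtain B where B: "\<And>x. x \<in> freq_interval h \<Longrightarrow> cmod (f x) \<le> B"
    by (auto simp: bounded_iff)
  show ?thesis
    by (rule L2_space_bounded[OF finite_measure_lebesgue_on
          continuous_imp_measurable_on_sets_lebesgue[OF f], where B = B])
      (auto intro: B)
qed

lemma freq_exp_L2: "freq_exp h n \<in> L2_space (lebesgue_on (freq_interval h))"
  by (intro continuous_L2_space_freq_interval continuous_on_freq_exp)

lemma integral_freq_exp: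
  assumes h: "h > 0"
  shows "(LINT \<xi>|lebesgue_on (freq_interval h). freq_exp h n \<xi>) = (if n = 0 then of_real (2 * pi / h) else 0)"
proof -
  let ?a = "- pi / h" and ?b = "pi / h"
  have ab: "?a \<le> ?b" using h by (simp add: field_simps)
  have int: "integrable (lebesgue_on (freq_interval h)) (freq_exp h n)"
    using L2_integrable_product[OF freq_exp_L2[of h n] freq_exp_L2[of h 0]] by simp
  have "(freq_exp h n has_integral (if n = 0 then of_real (2 * pi / h) else 0)) {?a..?b}"
  proof (cases "n = 0")
    case True
    have "((\<lambda>\<xi>::real. 1::complex) has_integral (?b - ?a) *\<^sub>R 1) {?a..?b}"
      using ab by (intro has_integral_const_real[THEN has_integral_eq_rhs]) auto
    moreover have "(?b - ?a) *\<^sub>R (1::complex) = of_real (2 * pi / h)"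
      by (simp add: of_real_def)
    moreover have "freq_exp h n = (\<lambda>_. 1)"
      using True by (auto simp: fun_eq_iff)
    ultimately show ?thesis using True by simp
  next
    case False
    let ?F = "\<lambda>\<xi>. (\<i> / (of_int n * of_real h)) * freq_exp h n \<xi>"
    have "(freq_exp h n has_integral ?F ?b - ?F ?a) {?a..?b}"
    proof (rule fundamental_theorem_of_calculus[OF ab])
      fix \<xi>
      have "(?F has_vector_derivative (\<i> / (of_int n * of_real h)) * (- \<i> * (of_int n * of_real h) * freq_exp h n \<xi>)) (at \<xi> within {?a..?b})"
        unfolding freq_exp_def of_real_mult of_real_of_int_eq
        by (rule has_vector_derivative_real_field) (auto intro!: derivative_eq_intros)
      then show "(?F has_vector_derivative freq_exp h n \<xi>) (at \<xi> within {?a..?b})"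
        using False h by simp
    qed
    \<comment> \<open>The interval consists of a whole number of periods, so the antiderivative
      takes equal values at both ends and the integral is 0.\<close>
    moreover have "freq_exp h n ?b = freq_exp h n ?a"
    proof -
      have "freq_exp h n ?b = cis (- (pi * of_int n))" "freq_exp h n ?a = cis (pi * of_int n)"
        using h by (simp_all add: freq_exp_cis)
      moreover have "sin (pi * of_int n) = 0"
        using sin_npi_int[of n] by (simp add: mult.commute)
      ultimately show ?thesis
        by (simp add: complex_eq_iff)
    qed
    ultimately show ?thesis using False by simp
  qed
  then show ?thesis
    using lebesgue_integral_eq_integral[OF int freq_interval_sets]
    by (simp add: freq_interval_def integral_unique)
qed

lemma orthogonal_system_freq_exp:
  assumes h: "h > 0"
  shows "orthogonal_system (lebesgue_on (freq_interval h)) (freq_exp h) (2 * pi / h)"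
proof
  show "2 * pi / h > 0" using h by simp
  fix m n
  show "(LINT \<xi>|lebesgue_on (freq_interval h). freq_exp h m \<xi> * cnj (freq_exp h n \<xi>))
      = (if m = n then of_real (2 * pi / h) else 0)"
    unfolding cnj_freq_exp freq_exp_mult integral_freq_exp[OF h] by simp
qed (rule freq_exp_L2)

section \<open>Density of trigonometric polynomials in L2 of the frequency interval\<close>

lemma lebesgue_on_freq_interval_AE_interior:
  "AE \<xi> in lebesgue_on (freq_interval h). \<xi> \<noteq> - pi / h \<and> \<xi> \<noteq> pi / h"
proof -
  have "negligible {- pi / h, pi / h}"
    by (simp add: negligible_finite)
  then have "AE \<xi> in lebesgue. \<xi> \<notin> {- pi / h, pi / h}"
    unfolding negligible_iff_null_sets by (rule AE_not_in)
  then show ?thesis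
    by (subst AE_restrict_space_iff) (auto elim: eventually_mono)
qed

lemma tendsto_mult_bounded_zero:
  fixes f g :: "'a \<Rightarrow> complex"
  assumes bound: "\<And>x. cmod (f x) \<le> B" and g: "(g \<longlongrightarrow> 0) F"
  shows "((\<lambda>x. f x * g x) \<longlongrightarrow> 0) F"
proof (rule Lim_null_comparison)
  show "\<forall>\<^sub>F x in F. cmod (f x * g x) \<le> B * cmod (g x)"
    by (intro always_eventually allI) (simp add: norm_mult bound mult_right_mono)
  show "((\<lambda>x. B * cmod (g x)) \<longlongrightarrow> 0) F"
    using tendsto_mult[OF tendsto_const[of B] tendsto_norm[OF g]] by simp
qed

text \<open>The cutoff removes the jump of the argument at \<open>-1\<close>.\<close>

lemma continuous_on_Arg_cutoff:
  fixes f :: "real \<Rightarrow> complex"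
  assumes f: "continuous_on UNIV f" and bound: "\<And>x. cmod (f x) \<le> B"
  shows "continuous_on (sphere 0 1) (\<lambda>z. f (Arg z / h) * of_real (min 1 (k * cmod (z + 1))))"
    (is "continuous_on _ ?F")
proof (intro continuous_at_imp_continuous_on ballI)
  fix z :: complex assume z: "z \<in> sphere 0 1"
  let ?\<chi> = "\<lambda>z. complex_of_real (min 1 (k * cmod (z + 1)))"
  have \<chi>: "isCont ?\<chi> z"
    by (intro continuous_intros)
  show "isCont ?F z"
  proof (cases "z = -1")
    case True
    \<comment> \<open>\<open>Arg\<close> jumps here, but \<open>f\<close> is bounded and the cutoff
      vanishes at -1, so the product tends to 0, which is also its value there.\<close>
    have "(?\<chi> \<longlongrightarrow> 0) (at z)"
      using \<chi> True by (simp add: isCont_def)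
    then have "(?F \<longlongrightarrow> 0) (at z)"
      by (rule tendsto_mult_bounded_zero[OF bound])
    then show ?thesis
      by (simp add: isCont_def True)
  next
    case False
    \<comment> \<open>On the unit circle the only nonpositive real is -1, so \<open>z\<close> avoids
      the branch cut of \<open>Arg\<close>.\<close>
    have "z \<notin> \<real>\<^sub>\<le>\<^sub>0"
    proof
      assume "z \<in> \<real>\<^sub>\<le>\<^sub>0"
      then obtain r where "z = of_real r" "r \<le> 0"
        by (auto elim: nonpos_Reals_cases)
      with z False show False by auto
    qed
    then have "isCont (\<lambda>z. Arg z / h) z"
      using continuous_at_Arg[of z] by (cases "h = 0") (auto intro!: continuous_intros)
    moreover have "isCont f (Arg z / h)"
      using f by (simp add: continuous_on_eq_continuous_at)
    ultimately have "isCont (\<lambda>z. f (Arg z / h)) z"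
      by (rule isCont_o2)
    then show ?thesis
      using \<chi> by (rule isCont_mult)
  qed
qed

text \<open>Continuous functions on the line converge to \<open>g\<close> almost everywhere on the
  interval. They are clipped to the bound \<open>B\<close>, carried to the circle by
  \<open>Arg\<close>, and made continuous at -1 by a cutoff; dominated convergence finishes. The
  circle is the target because Stone-Weierstrass is applied there.\<close>

lemma circle_functions_dense_bounded:
  assumes h: "h > 0" and g: "g \<in> borel_measurable (lebesgue_on (freq_interval h))"
    and bound: "\<And>\<xi>. \<xi> \<in> freq_interval h \<Longrightarrow> cmod (g \<xi>) \<le> B" and \<epsilon>: "\<epsilon> > 0"
  obtains F where "continuous_on (sphere 0 1) F"
    "(LINT \<xi>|lebesgue_on (freq_interval h). (cmod (g \<xi> - F (cis (\<xi> * h))))\<^sup>2) < \<epsilon>"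
proof -
  let ?I = "freq_interval h"
  let ?M = "lebesgue_on ?I"
  have "0 \<in> ?I" using h by (simp add: freq_interval_def)
  then have B: "B \<ge> 0"
    using bound[of 0] norm_ge_zero order_trans by blast
  obtain N f where N: "negligible N" and f: "\<And>k::nat. continuous_on UNIV (f k)"
    and lim: "\<And>\<xi>. \<xi> \<notin> N \<Longrightarrow> (\<lambda>k. f k \<xi>) \<longlonglongrightarrow> (if \<xi> \<in> ?I then g \<xi> else 0)"
    using g measurable_on_iff_borel_measurable[OF freq_interval_sets, of g h]
    unfolding measurable_on_def by blast
  \<comment> \<open>The projection onto the ball is continuous and fixes the values of
    \<open>g\<close> on the interval, so clipping keeps continuity and the limit while providing a
    constant dominating function.\<close>
  let ?P = "closest_point (cball 0 B) :: complex \<Rightarrow> complex"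
  have P: "isCont ?P z" "cmod (?P z) \<le> B" for z
    using continuous_at_closest_point[of "cball 0 B" z] closest_point_in_set[of "cball 0 B" z] B
    by auto
  have P_id: "?P z = z" if "cmod z \<le> B" for z
    using that by (intro closest_point_self) auto
  have Pf: "continuous_on UNIV (\<lambda>\<xi>. ?P (f k \<xi>))" for k
    using f[of k] P(1) by (auto simp: continuous_on_eq_continuous_at intro: isCont_o2)
  \<comment> \<open>The slope \<open>k\<close> of the cutoff grows, so at each point other than -1
    the cutoff is eventually 1.\<close>
  let ?F = "\<lambda>k z. ?P (f k (Arg z / h)) * complex_of_real (min 1 (real k * cmod (z + 1)))"
  have F: "continuous_on (sphere 0 1) (?F k)" for k
    using Pf[of k] P(2) by (rule continuous_on_Arg_cutoff)
  have F_bound: "cmod (?F k z) \<le> B" for k z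
  proof -
    have "cmod (?F k z) \<le> B * 1"
      unfolding norm_mult norm_of_real by (intro mult_mono P(2) B) auto
    then show ?thesis by simp
  qed
  have "(\<lambda>k. LINT \<xi>|?M. (cmod (g \<xi> - ?F k (cis (\<xi> * h))))\<^sup>2) \<longlonglongrightarrow> 0"
  proof (rule L2_dominated_convergence[OF g, where w = "\<lambda>_. (2 * B)\<^sup>2"])
    have "continuous_on ?I (\<lambda>\<xi>. ?F k (cis (\<xi> * h)))" for k
      by (rule continuous_on_compose2[OF F]) (auto intro!: continuous_intros)
    then show "(\<lambda>\<xi>. ?F k (cis (\<xi> * h))) \<in> borel_measurable ?M" for k
      by (intro continuous_imp_measurable_on_sets_lebesgue freq_interval_sets)
    show "integrable ?M (\<lambda>_. (2 * B)\<^sup>2)"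
      by (intro finite_measure.integrable_const finite_measure_lebesgue_on freq_interval_lmeasurable)
    show "AE \<xi> in ?M. (cmod (?F k (cis (\<xi> * h)) - g \<xi>))\<^sup>2 \<le> (2 * B)\<^sup>2" for k
    proof (rule AE_I2)
      fix \<xi> assume "\<xi> \<in> space ?M"
      then have "cmod (?F k (cis (\<xi> * h)) - g \<xi>) \<le> B + B"
        using norm_triangle_ineq4[of "?F k (cis (\<xi> * h))" "g \<xi>"] F_bound[of k "cis (\<xi> * h)"] bound[of \<xi>]
        by simp
      then show "(cmod (?F k (cis (\<xi> * h)) - g \<xi>))\<^sup>2 \<le> (2 * B)\<^sup>2"
        by (intro power_mono) auto
    qed
    have "AE \<xi> in lebesgue. \<xi> \<notin> N"
      using N by (simp add: AE_not_in negligible_iff_null_sets)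
    then have "AE \<xi> in ?M. \<xi> \<notin> N"
      by (subst AE_restrict_space_iff) (auto elim: eventually_mono)
    with lebesgue_on_freq_interval_AE_interior[of h] AE_space[of ?M]
    show "AE \<xi> in ?M. (\<lambda>k. ?F k (cis (\<xi> * h))) \<longlonglongrightarrow> g \<xi>"
    proof eventually_elim
      case (elim \<xi>)
      then have "- pi / h < \<xi>" "\<xi> < pi / h"
        by (auto simp: freq_interval_def)
      then have range: "- pi < \<xi> * h" "\<xi> * h < pi"
        using h by (auto simp: field_simps)
      then have Arg: "Arg (cis (\<xi> * h)) / h = \<xi>"
        using h by (simp add: Arg_cis)
      \<comment> \<open>Only the endpoints of the frequency interval are mapped to -1, and they were
        discarded as a null set.\<close>
      have "cis (\<xi> * h) \<noteq> -1"
      proof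
        assume "cis (\<xi> * h) = -1"
        then have "Arg (cis (\<xi> * h)) = pi" by (simp add: Arg_minus)
        with range show False by (simp add: Arg_cis)
      qed
      then have pos: "cmod (cis (\<xi> * h) + 1) > 0"
        by (simp add: add_eq_0_iff2)
      have "eventually (\<lambda>k. real k * cmod (cis (\<xi> * h) + 1) \<ge> 1) sequentially"
      proof -
        obtain K :: nat where K: "1 < real K * cmod (cis (\<xi> * h) + 1)"
          using reals_Archimedean3[OF pos] by blast
        have "1 \<le> real k * cmod (cis (\<xi> * h) + 1)" if "K \<le> k" for k
        proof -
          have "real K * cmod (cis (\<xi> * h) + 1) \<le> real k * cmod (cis (\<xi> * h) + 1)"
            using that by (intro mult_right_mono) auto
          with K show ?thesis by linarith
        qed
        then show ?thesis
          unfolding eventually_sequentially by blast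
      qed
      then have \<chi>: "(\<lambda>k. complex_of_real (min 1 (real k * cmod (cis (\<xi> * h) + 1)))) \<longlonglongrightarrow> 1"
        by (intro tendsto_eventually) (auto elim: eventually_mono)
      have "(\<lambda>k. f k \<xi>) \<longlonglongrightarrow> g \<xi>"
        using lim[of \<xi>] elim by simp
      then have "(\<lambda>k. ?P (f k \<xi>)) \<longlonglongrightarrow> ?P (g \<xi>)"
        by (rule isCont_tendsto_compose[OF P(1)])
      also have "?P (g \<xi>) = g \<xi>"
        using elim by (intro P_id bound) auto
      finally show ?case
        using tendsto_mult[OF _ \<chi>] unfolding Arg by fastforce
    qed
  qed
  then have "\<forall>\<^sub>F k in sequentially. (LINT \<xi>|?M. (cmod (g \<xi> - ?F k (cis (\<xi> * h))))\<^sup>2) < \<epsilon>"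
    using \<epsilon> by (rule order_tendstoD)
  from eventually_happens'[OF sequentially_bot this]
  obtain k where "(LINT \<xi>|?M. (cmod (g \<xi> - ?F k (cis (\<xi> * h))))\<^sup>2) < \<epsilon>"
    ..
  with F[of k] show thesis by (rule that)
qed

text \<open>Values of modulus above \<open>k\<close> are replaced by 0. The error never exceeds
  \<open>g\<close> in modulus, so the squared modulus of \<open>g\<close> dominates.\<close>

lemma L2_truncation:
  assumes g: "g \<in> L2_space M" and \<epsilon>: "\<epsilon> > 0"
  obtains g' B where "g' \<in> borel_measurable M" "\<And>x. cmod (g' x) \<le> B"
    "(LINT x|M. (cmod (g x - g' x))\<^sup>2) < \<epsilon>"
proof -
  note [measurable] = L2_spaceD(1)[OF g]
  let ?g = "\<lambda>k x. if cmod (g x) \<le> real k then g x else 0"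
  have meas: "?g k \<in> borel_measurable M" for k
    by measurable
  have "(\<lambda>k. LINT x|M. (cmod (g x - ?g k x))\<^sup>2) \<longlonglongrightarrow> 0"
  proof (rule L2_dominated_convergence[OF _ meas, where w = "\<lambda>x. (cmod (g x))\<^sup>2"])
    show "AE x in M. (\<lambda>k. ?g k x) \<longlonglongrightarrow> g x"
    proof (intro AE_I2 tendsto_eventually)
      fix x
      have "\<forall>\<^sub>F k in sequentially. cmod (g x) \<le> real k"
        using real_arch_simple[of "cmod (g x)"] unfolding eventually_sequentially
        by (meson of_nat_mono order_trans)
      then show "\<forall>\<^sub>F k in sequentially. ?g k x = g x"
        by (rule eventually_mono) simp
    qed
  qed (use L2_spaceD[OF g] in auto)
  then have "\<forall>\<^sub>F k in sequentially. (LINT x|M. (cmod (g x - ?g k x))\<^sup>2) < \<epsilon>"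
    using \<epsilon> by (rule order_tendstoD)
  from eventually_happens'[OF sequentially_bot this]
  obtain k where k: "(LINT x|M. (cmod (g x - ?g k x))\<^sup>2) < \<epsilon>"
    ..
  show thesis
    by (rule that[of "?g k" "real k"]) (use k meas in auto)
qed

text \<open>Three successive approximations: by a bounded function, by a continuous function on the
  circle, and uniformly by a trigonometric polynomial. Two uses of \<open>L2_integral_add_le\<close>
  turn the errors \<open>\<epsilon> / 8\<close>, \<open>\<epsilon> / 16\<close>,
  \<open>\<epsilon> / 16\<close> into at most \<open>2/8 + 4/16 + 4/16 = 3/4\<close> of
  \<open>\<epsilon>\<close>.\<close>

lemma trig_poly_L2_dense:
  assumes h: "h > 0" and g: "g \<in> L2_space (lebesgue_on (freq_interval h))" and \<epsilon>: "\<epsilon> > 0"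
  obtains p where "trig_poly h p"
    "(LINT \<xi>|lebesgue_on (freq_interval h). (cmod (g \<xi> - p \<xi>))\<^sup>2) < \<epsilon>"
proof -
  let ?I = "freq_interval h"
  let ?M = "lebesgue_on ?I"
  obtain g' B where g': "g' \<in> borel_measurable ?M" and B: "\<And>x. cmod (g' x) \<le> B"
    and gg': "(LINT \<xi>|?M. (cmod (g \<xi> - g' \<xi>))\<^sup>2) < \<epsilon> / 8"
    by (rule L2_truncation[OF g, of "\<epsilon> / 8"]) (use \<epsilon> in auto)
  have g'_L2: "g' \<in> L2_space ?M"
    by (rule L2_space_bounded[OF finite_measure_lebesgue_on g' B]) auto
  obtain F where F: "continuous_on (sphere 0 1) F"
    and g'F: "(LINT \<xi>|?M. (cmod (g' \<xi> - F (cis (\<xi> * h))))\<^sup>2) < \<epsilon> / 16"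
    by (rule circle_functions_dense_bounded[OF h g' B, of "\<epsilon> / 16"]) (use \<epsilon> in auto)
  \<comment> \<open>Chosen so that the uniform error, squared and integrated over an interval of
    length \<open>2 * pi / h\<close>, contributes \<open>\<epsilon> / 16\<close>.\<close>
  define \<eta> where "\<eta> = sqrt (\<epsilon> * h / (32 * pi))"
  have \<eta>: "\<eta> > 0" "\<eta>\<^sup>2 = \<epsilon> * h / (32 * pi)"
    using \<epsilon> h by (simp_all add: \<eta>_def)
  obtain p where p: "trig_poly h p" and Fp: "\<And>\<xi>. cmod (F (cis (\<xi> * h)) - p \<xi>) < \<eta>"
    by (rule trig_poly_uniformly_dense[OF F \<eta>(1), of h]) blast
  have F_L2: "(\<lambda>\<xi>. F (cis (\<xi> * h))) \<in> L2_space ?M"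
    by (intro continuous_L2_space_freq_interval continuous_on_compose2[OF F])
      (auto intro!: continuous_intros)
  have p_L2: "p \<in> L2_space ?M"
    using p by (auto simp: trig_poly_def intro!: L2_space_sum L2_space_cmult freq_exp_L2)
  have "(LINT \<xi>|?M. (cmod (F (cis (\<xi> * h)) - p \<xi>))\<^sup>2) \<le> (LINT \<xi>|?M. \<eta>\<^sup>2)"
    by (intro integral_mono L2_spaceD(2) L2_space_diff F_L2 p_L2 finite_measure.integrable_const
        finite_measure_lebesgue_on freq_interval_lmeasurable power_mono less_imp_le[OF Fp]) auto
  also have "\<dots> = \<eta>\<^sup>2 * (2 * pi / h)"
    using h by (simp add: measure_restrict_space freq_interval_def field_simps)
  also have "\<dots> = \<epsilon> / 16"
    using h \<eta>(2) by simp
  finally have Fp': "(LINT \<xi>|?M. (cmod (F (cis (\<xi> * h)) - p \<xi>))\<^sup>2) \<le> \<epsilon> / 16" .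
  have "(LINT \<xi>|?M. (cmod (g' \<xi> - p \<xi>))\<^sup>2)
      \<le> 2 * (LINT \<xi>|?M. (cmod (g' \<xi> - F (cis (\<xi> * h))))\<^sup>2) + 2 * (LINT \<xi>|?M. (cmod (F (cis (\<xi> * h)) - p \<xi>))\<^sup>2)"
    using L2_integral_add_le[OF L2_space_diff[OF g'_L2 F_L2] L2_space_diff[OF F_L2 p_L2]] by simp
  moreover have "(LINT \<xi>|?M. (cmod (g \<xi> - p \<xi>))\<^sup>2)
      \<le> 2 * (LINT \<xi>|?M. (cmod (g \<xi> - g' \<xi>))\<^sup>2) + 2 * (LINT \<xi>|?M. (cmod (g' \<xi> - p \<xi>))\<^sup>2)"
    using L2_integral_add_le[OF L2_space_diff[OF g g'_L2] L2_space_diff[OF g'_L2 p_L2]] by simp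
  ultimately have "(LINT \<xi>|?M. (cmod (g \<xi> - p \<xi>))\<^sup>2) < \<epsilon>"
    using gg' g'F Fp' \<epsilon> by linarith
  with p show thesis by (rule that)
qed

section \<open>The discrete Fourier transform and its inverse\<close>

lemma inv_dft_eq_coef:
  assumes h: "h > 0"
  shows "inv_dft h g n = of_real (1 / sqrt (2 * pi)) *
    orthogonal_system.coef (lebesgue_on (freq_interval h)) (freq_exp h) g n"
  unfolding inv_dft_def orthogonal_system.coef_def[OF orthogonal_system_freq_exp[OF h]]
    cnj_freq_exp by (simp add: freq_exp_def mult_ac)

text \<open>Completeness of the exponentials makes the Fourier series of \<open>g\<close> converge
  to \<open>g\<close>, and this series is the defining series of the transform of
  \<open>inv_dft h g\<close>.\<close>

lemma is_dft_inv_dft: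
  assumes h: "h > 0" and g: "g \<in> L2_space (lebesgue_on (freq_interval h))"
  shows "is_dft h (inv_dft h g) g"
proof -
  interpret orthogonal_system "lebesgue_on (freq_interval h)" "freq_exp h" "2 * pi / h"
    using h by (rule orthogonal_system_freq_exp)
  have "L2_tendsto (lebesgue_on (freq_interval h))
      (\<lambda>N \<xi>. \<Sum>n\<in>N. (coef g n / (2 * pi / h)) * freq_exp h n \<xi>) g (finite_subsets_at_top UNIV)"
    using g
  proof (rule L2_tendsto_fourier_series)
    fix \<epsilon> :: real assume "\<epsilon> > 0"
    from trig_poly_L2_dense[OF h g this] obtain p where "trig_poly h p"
      "(LINT \<xi>|lebesgue_on (freq_interval h). (cmod (g \<xi> - p \<xi>))\<^sup>2) < \<epsilon>" .
    then show "\<exists>N c. finite N \<and> (LINT \<xi>|lebesgue_on (freq_interval h).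
        (cmod (g \<xi> - (\<Sum>n\<in>N. c n * freq_exp h n \<xi>)))\<^sup>2) < \<epsilon>"
      by (auto simp: trig_poly_def)
  qed
  moreover have "(\<Sum>n\<in>N. (coef g n / (2 * pi / h)) * freq_exp h n \<xi>)
      = of_real (h / sqrt (2 * pi)) *
        (\<Sum>n\<in>N. exp (- \<i> * of_real (\<xi> * of_int n * h)) * inv_dft h g n)" for N \<xi>
  proof -
    \<comment> \<open>With \<open>K = 2 * pi / h\<close>, the factor \<open>1 / K\<close> splits
      into the constants of the forward and of the inverse transform.\<close>
    have "h / (2 * pi) = h / sqrt (2 * pi) * (1 / sqrt (2 * pi))"
      by simp
    then have c: "complex_of_real (h / (2 * pi)) = of_real (h / sqrt (2 * pi)) * of_real (1 / sqrt (2 * pi))"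
      by (metis of_real_mult)
    have "(coef g n / (2 * pi / h)) * freq_exp h n \<xi>
      = of_real (h / sqrt (2 * pi)) * (freq_exp h n \<xi> * inv_dft h g n)" for n
    proof -
      have "(coef g n / (2 * pi / h)) = of_real (h / (2 * pi)) * coef g n"
        by simp
      then show ?thesis
        unfolding c inv_dft_eq_coef[OF h] by (simp only: mult_ac)
    qed
    then show ?thesis
      by (simp add: sum_distrib_left freq_exp_def)
  qed
  ultimately show ?thesis
    using g unfolding is_dft_def by simp
qed

text \<open>\<open>SOME\<close> has a witness by \<open>is_dft_inv_dft\<close>; the function it
  picks and \<open>g\<close> are limits of the same partial sums.\<close>

lemma dft_inv_dft:
  assumes h: "h > 0" and g: "g \<in> L2_space (lebesgue_on (freq_interval h))"
  shows "dft h (inv_dft h g) \<in> L2_space (lebesgue_on (freq_interval h))"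
    and "AE \<xi> in lebesgue_on (freq_interval h). dft h (inv_dft h g) \<xi> = g \<xi>"
proof -
  have dft: "is_dft h (inv_dft h g) (dft h (inv_dft h g))"
    using someI[of "is_dft h (inv_dft h g)", OF is_dft_inv_dft[OF h g]] unfolding dft_def .
  then show L2: "dft h (inv_dft h g) \<in> L2_space (lebesgue_on (freq_interval h))"
    by (simp add: is_dft_def)
  have meas: "(\<lambda>\<xi>. of_real (h / sqrt (2 * pi)) *
      (\<Sum>n\<in>N. exp (- \<i> * of_real (\<xi> * of_int n * h)) * inv_dft h g n))
      \<in> borel_measurable (lebesgue_on (freq_interval h))" for N
    by (intro continuous_imp_measurable_on_sets_lebesgue freq_interval_sets continuous_intros)
  show "AE \<xi> in lebesgue_on (freq_interval h). dft h (inv_dft h g) \<xi> = g \<xi>"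
    by (rule L2_tendsto_unique[OF L2_spaceD(1)[OF L2] L2_spaceD(1)[OF g] meas
          finite_subsets_at_top_neq_bot])
      (use dft is_dft_inv_dft[OF h g] in \<open>auto simp: is_dft_def\<close>)
qed

text \<open>Bessel's inequality, in which the factors \<open>2 * pi / h\<close>,
  \<open>1 / (2 * pi)\<close> and \<open>h\<close> cancel to the constant 1. The bound on finite
  sums also yields summability, which excludes the infinite branch of
  \<open>l2h_norm\<close>.\<close>

lemma l2h_norm_inv_dft_le:
  assumes h: "h > 0" and g: "g \<in> L2_space (lebesgue_on (freq_interval h))"
  shows "l2h_norm h (inv_dft h g) \<le> ennreal (L2_norm (lebesgue_on (freq_interval h)) g)"
proof -
  interpret orthogonal_system "lebesgue_on (freq_interval h)" "freq_exp h" "2 * pi / h"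
    using h by (rule orthogonal_system_freq_exp)
  let ?A = "LINT \<xi>|lebesgue_on (freq_interval h). (cmod (g \<xi>))\<^sup>2"
  have sq: "(cmod (inv_dft h g n))\<^sup>2 = (cmod (coef g n))\<^sup>2 / (2 * pi)" for n
    unfolding inv_dft_eq_coef[OF h] norm_mult norm_of_real power_mult_distrib
    by (simp add: power_divide)
  have fin: "(\<Sum>n\<in>N. (cmod (inv_dft h g n))\<^sup>2) \<le> ?A / h" if "finite N" for N
  proof -
    have "(\<Sum>n\<in>N. (cmod (inv_dft h g n))\<^sup>2) = (\<Sum>n\<in>N. (cmod (coef g n))\<^sup>2) / (2 * pi)"
      by (simp add: sq sum_divide_distrib)
    also have "\<dots> \<le> (2 * pi / h * ?A) / (2 * pi)"
      by (intro divide_right_mono bessel g that) auto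
    finally show ?thesis by simp
  qed
  have summable: "(\<lambda>n. (cmod (inv_dft h g n))\<^sup>2) summable_on UNIV"
    by (rule nonneg_bdd_above_summable_on) (auto intro!: bdd_aboveI[where M = "?A / h"] fin)
  have "(\<Sum>\<^sub>\<infinity>n. (cmod (inv_dft h g n))\<^sup>2) \<le> ?A / h"
    using summable fin by (rule infsum_le_finite_sums)
  then have "h * (\<Sum>\<^sub>\<infinity>n. (cmod (inv_dft h g n))\<^sup>2) \<le> ?A"
    using h by (simp add: field_simps)
  then show ?thesis
    using summable by (simp add: l2h_norm_def l2h_space_def L2_norm_def ennreal_leI)
qed

lemma inv_dft_cong_AE:
  assumes p: "p \<in> borel_measurable (lebesgue_on (freq_interval h))"
    and q: "q \<in> borel_measurable (lebesgue_on (freq_interval h))"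
    and eq: "AE \<xi> in lebesgue_on (freq_interval h). p \<xi> = q \<xi>"
  shows "inv_dft h p = inv_dft h q"
proof
  fix n
  have e: "(\<lambda>\<xi>. exp (\<i> * of_real (\<xi> * of_int n * h))) \<in> borel_measurable (lebesgue_on (freq_interval h))"
    by (intro continuous_imp_measurable_on_sets_lebesgue freq_interval_sets continuous_intros)
  show "inv_dft h p n = inv_dft h q n"
    unfolding inv_dft_def
    by (intro arg_cong2[of _ _ _ _ "(*)"] refl integral_cong_AE borel_measurable_times e p q)
      (use eq in eventually_elim, simp)
qed

text \<open>The almost everywhere equality of \<open>dft_inv_dft\<close> becomes an exact equality
  of sequences, since every entry of \<open>inv_dft\<close> is an integral.\<close>

lemma localization_inv_dft:
  assumes h: "h > 0" and g: "g \<in> L2_space (lebesgue_on (freq_interval h))"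
    and \<phi>: "\<phi> j \<in> borel_measurable (lebesgue_on (freq_interval h))"
  shows "localization h \<phi> j (inv_dft h g) = inv_dft h (\<lambda>\<xi>. g \<xi> * of_real (\<phi> j \<xi>))"
  unfolding localization_def
proof (rule inv_dft_cong_AE)
  note [measurable] = L2_spaceD(1)[OF g] L2_spaceD(1)[OF dft_inv_dft(1)[OF h g]] \<phi>
  show "(\<lambda>\<xi>. dft h (inv_dft h g) \<xi> * of_real (\<phi> j \<xi>)) \<in> borel_measurable (lebesgue_on (freq_interval h))"
    "(\<lambda>\<xi>. g \<xi> * of_real (\<phi> j \<xi>)) \<in> borel_measurable (lebesgue_on (freq_interval h))"
    by measurable
  show "AE \<xi> in lebesgue_on (freq_interval h).
      dft h (inv_dft h g) \<xi> * of_real (\<phi> j \<xi>) = g \<xi> * of_real (\<phi> j \<xi>)"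
    using dft_inv_dft(2)[OF h g] by eventually_elim simp
qed

section \<open>Dyadic shells and the Sobolev decay of the localized pieces\<close>

lemma dyadic_shell_lower_bound:
  assumes h: "h > 0" and \<xi>: "\<xi> \<in> dyadic_shell h j"
  shows "3/4 * 2 powi j \<le> \<bar>\<xi>\<bar>"
proof -
  have "3/4 * 2 powi j \<le> \<bar>sin (\<xi> * h) / h\<bar>"
    using \<xi> by (simp add: dyadic_shell_def)
  also have "\<dots> \<le> \<bar>\<xi> * h\<bar> / h"
    using h abs_sin_x_le_abs_x[of "\<xi> * h"] by (simp add: abs_divide divide_right_mono)
  also have "\<dots> = \<bar>\<xi>\<bar>"
    using h by (simp add: abs_mult)
  finally show ?thesis .
qed

lemma dyadic_partition_bounds:
  assumes \<phi>: "dyadic_partition h \<phi>" and \<xi>: "\<xi> \<in> freq_interval h"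
  shows "0 \<le> \<phi> j \<xi>" "\<phi> j \<xi> \<le> 1" "\<phi> j \<xi> \<noteq> 0 \<Longrightarrow> \<xi> \<in> dyadic_shell h j"
proof -
  have "\<phi> j \<xi> \<in> {0..1}"
    using \<phi> \<xi> unfolding dyadic_partition_def by blast
  then show "0 \<le> \<phi> j \<xi>" "\<phi> j \<xi> \<le> 1"
    by auto
  have "{\<xi> \<in> freq_interval h. \<phi> j \<xi> \<noteq> 0} \<subseteq> dyadic_shell h j"
    using \<phi> closure_subset unfolding dyadic_partition_def by (meson order_trans)
  then show "\<xi> \<in> dyadic_shell h j" if "\<phi> j \<xi> \<noteq> 0"
    using \<xi> that by blast
qed

text \<open>For \<open>j \<ge> 0\<close> this is the reciprocal of
  \<open>(3/4 * 2 powi j) powr s\<close>, a lower bound of the weight on the shell. For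
  \<open>j < 0\<close> the constant 1 would do; the larger \<open>(4/3) powr s\<close> gives both
  ranges the same prefactor.\<close>

definition sobolev_decay :: "real \<Rightarrow> int \<Rightarrow> real" where
  "sobolev_decay s j = (4/3) powr s * (if j \<ge> 0 then 2 powr (- of_int j * s) else 1)"

lemma sobolev_weight_bound:
  assumes s: "s > 0" and x: "3/4 * 2 powi j \<le> \<bar>x\<bar>"
  shows "1 \<le> sobolev_decay s j * (1 + x\<^sup>2) powr (s / 2)"
proof (cases "j \<ge> 0")
  case True
  \<comment> \<open>The lower edge of the shell, written with \<open>powr\<close> so that raising it
    to the real power \<open>s\<close> combines the exponents.\<close>
  define y :: real where "y = 3/4 * 2 powr of_int j"
  have y: "0 < y" "y \<le> \<bar>x\<bar>"
    using x by (auto simp: y_def powr_real_of_int')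
  have "y powr s = (y powr 2) powr (s / 2)"
    by (simp add: powr_powr)
  also have "\<dots> \<le> (1 + x\<^sup>2) powr (s / 2)"
    using s y power_mono[of y "\<bar>x\<bar>" 2] by (intro powr_mono2) auto
  finally have le: "y powr s \<le> (1 + x\<^sup>2) powr (s / 2)" .
  have "y powr s = (3/4) powr s * 2 powr (of_int j * s)"
    unfolding y_def by (subst powr_mult) (simp_all add: powr_powr)
  then have "sobolev_decay s j * y powr s = ((4/3) powr s * (3/4) powr s) * (2 powr (- of_int j * s) * 2 powr (of_int j * s))"
    using True by (simp add: sobolev_decay_def)
  also have "\<dots> = 1"
    by (simp add: powr_mult[symmetric] powr_add[symmetric])
  finally have "1 = sobolev_decay s j * y powr s" ..
  also have "\<dots> \<le> sobolev_decay s j * (1 + x\<^sup>2) powr (s / 2)"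
    using le by (intro mult_left_mono) (auto simp: sobolev_decay_def)
  finally show ?thesis .
next
  case False
  have "1 \<le> (1 + x\<^sup>2) powr (s / 2)"
    using s by (intro ge_one_powr_ge_zero) auto
  moreover have "1 \<le> sobolev_decay s j"
    using False s by (auto simp: sobolev_decay_def intro!: ge_one_powr_ge_zero)
  ultimately show ?thesis
    using mult_mono[of 1 "sobolev_decay s j" 1 "(1 + x\<^sup>2) powr (s / 2)"] by simp
qed

text \<open>Where \<open>\<phi> j\<close> is nonzero the frequency lies in the shell, and
  \<open>sobolev_weight_bound\<close> gives the estimate pointwise; elsewhere the left side is 0.
  Monotonicity of the integral then enlarges the interval to the whole line.\<close>

lemma L2_norm_localized_le:
  assumes s: "s > 0" and h: "h > 0" and \<phi>: "dyadic_partition h \<phi>"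
    and g: "g \<in> borel_measurable lebesgue"
    and wg: "(\<lambda>\<xi>. of_real ((1 + \<xi>\<^sup>2) powr (s / 2)) * g \<xi>) \<in> L2_space lebesgue"
  shows "(\<lambda>\<xi>. g \<xi> * of_real (\<phi> j \<xi>)) \<in> L2_space (lebesgue_on (freq_interval h))"
    and "L2_norm (lebesgue_on (freq_interval h)) (\<lambda>\<xi>. g \<xi> * of_real (\<phi> j \<xi>))
       \<le> sobolev_decay s j * L2_norm lebesgue (\<lambda>\<xi>. of_real ((1 + \<xi>\<^sup>2) powr (s / 2)) * g \<xi>)"
proof -
  let ?I = "freq_interval h"
  let ?M = "lebesgue_on ?I"
  let ?w = "\<lambda>\<xi>. of_real ((1 + \<xi>\<^sup>2) powr (s / 2)) * g \<xi>"
  let ?D = "sobolev_decay s j"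
  have D: "?D \<ge> 0" by (auto simp: sobolev_decay_def)
  have pointwise: "(cmod (g \<xi> * of_real (\<phi> j \<xi>)))\<^sup>2 \<le> ?D\<^sup>2 * (cmod (?w \<xi>))\<^sup>2" if \<xi>: "\<xi> \<in> ?I" for \<xi>
  proof (cases "\<phi> j \<xi> = 0")
    case False
    note b = dyadic_partition_bounds[OF \<phi> \<xi>, of j]
    have "cmod (g \<xi> * of_real (\<phi> j \<xi>)) = cmod (g \<xi>) * \<phi> j \<xi>"
      using b by (simp add: norm_mult)
    also have "\<dots> \<le> cmod (g \<xi>) * 1"
      using b by (intro mult_left_mono) auto
    also have "\<dots> \<le> cmod (g \<xi>) * (?D * (1 + \<xi>\<^sup>2) powr (s / 2))"
      using sobolev_weight_bound[OF s dyadic_shell_lower_bound[OF h b(3)[OF False]]]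
      by (intro mult_left_mono) auto
    also have "\<dots> = ?D * cmod (?w \<xi>)"
      by (simp add: norm_mult)
    finally show ?thesis
      unfolding power_mult_distrib[symmetric] by (intro power_mono) auto
  qed simp
  have int_leb: "integrable lebesgue (\<lambda>\<xi>. (cmod (?w \<xi>))\<^sup>2)"
    using wg by (rule L2_spaceD)
  then have ind: "integrable lebesgue (\<lambda>\<xi>. indicator ?I \<xi> *\<^sub>R (cmod (?w \<xi>))\<^sup>2)"
    by (intro integrable_mult_indicator freq_interval_sets)
  then have int: "integrable ?M (\<lambda>\<xi>. (cmod (?w \<xi>))\<^sup>2)"
    by (subst integrable_restrict_space) auto
  have g': "g \<in> borel_measurable ?M"
    using g by (rule measurable_restrict_space1)
  have \<phi>': "\<phi> j \<in> borel_measurable ?M"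
    using \<phi> by (simp add: dyadic_partition_def)
  note [measurable] = g' \<phi>'
  show L2: "(\<lambda>\<xi>. g \<xi> * of_real (\<phi> j \<xi>)) \<in> L2_space ?M"
  proof (rule L2_space_bound)
    show "integrable ?M (\<lambda>\<xi>. ?D\<^sup>2 * (cmod (?w \<xi>))\<^sup>2)"
      using int by (rule integrable_mult_right)
  qed (use pointwise in auto)
  have "(LINT \<xi>|?M. (cmod (g \<xi> * of_real (\<phi> j \<xi>)))\<^sup>2) \<le> (LINT \<xi>|?M. ?D\<^sup>2 * (cmod (?w \<xi>))\<^sup>2)"
    by (intro integral_mono L2_spaceD(2)[OF L2] integrable_mult_right int) (use pointwise in auto)
  also have "\<dots> = ?D\<^sup>2 * (LINT \<xi>|?M. (cmod (?w \<xi>))\<^sup>2)"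
    by simp
  also have "(LINT \<xi>|?M. (cmod (?w \<xi>))\<^sup>2) = (LINT \<xi>|lebesgue. indicator ?I \<xi> *\<^sub>R (cmod (?w \<xi>))\<^sup>2)"
    by (subst integral_restrict_space) auto
  also have "\<dots> \<le> (LINT \<xi>|lebesgue. (cmod (?w \<xi>))\<^sup>2)"
    using ind int_leb by (intro integral_mono) (auto split: split_indicator)
  finally have "(LINT \<xi>|?M. (cmod (g \<xi> * of_real (\<phi> j \<xi>)))\<^sup>2) \<le> ?D\<^sup>2 * (LINT \<xi>|lebesgue. (cmod (?w \<xi>))\<^sup>2)"
    by (simp add: mult_left_mono)
  from real_sqrt_le_mono[OF this]
  show "L2_norm ?M (\<lambda>\<xi>. g \<xi> * of_real (\<phi> j \<xi>)) \<le> ?D * L2_norm lebesgue ?w"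
    using D by (simp add: L2_norm_def real_sqrt_mult)
qed

section \<open>Summation of the dyadic series and the final estimate\<close>

lemma sum_int_geometric_le:
  fixes q :: real
  assumes q: "0 < q" "q < 1" and F: "finite F"
  shows "(\<Sum>j\<in>F. q ^ nat \<bar>j\<bar>) \<le> 2 / (1 - q)"
proof -
  \<comment> \<open>Applied to the nonnegative and to the negative indices, where
    \<open>nat \<bar>j\<bar>\<close> is injective in \<open>j\<close>; each half costs at most one
    full geometric series, hence the factor 2.\<close>
  have part: "(\<Sum>j\<in>A. q ^ nat \<bar>j\<bar>) \<le> 1 / (1 - q)"
    if A: "finite A" "inj_on (\<lambda>j. nat \<bar>j\<bar>) A" for A :: "int set"
  proof -
    have "(\<Sum>j\<in>A. q ^ nat \<bar>j\<bar>) = (\<Sum>k\<in>(\<lambda>j. nat \<bar>j\<bar>) ` A. q ^ k)"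
      using A by (simp add: sum.reindex)
    also have "\<dots> \<le> (\<Sum>k. q ^ k)"
      using q A by (intro sum_le_suminf) (auto intro: summable_geometric)
    also have "\<dots> = 1 / (1 - q)"
      using q by (intro suminf_geometric) auto
    finally show ?thesis .
  qed
  have "(\<Sum>j\<in>F. q ^ nat \<bar>j\<bar>)
      = (\<Sum>j\<in>F \<inter> {0..}. q ^ nat \<bar>j\<bar>) + (\<Sum>j\<in>F \<inter> {..<0}. q ^ nat \<bar>j\<bar>)"
    using F by (subst sum.union_disjoint[symmetric]) (auto intro!: sum.cong)
  also have "\<dots> \<le> 1 / (1 - q) + 1 / (1 - q)"
    using F by (intro add_mono part) (auto simp: inj_on_def)
  finally show ?thesis by simp
qed

text \<open>Up to the prefactor, the term is a power of \<open>2 powr (s - s')\<close> for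
  \<open>j \<ge> 0\<close> and of \<open>2 powr (- s)\<close> for \<open>j < 0\<close>, both with
  exponent \<open>nat \<bar>j\<bar>\<close>; the maximum of the two ratios covers both
  ranges.\<close>

lemma weighted_sobolev_decay_le:
  assumes s: "0 < s" "s < s'"
  shows "2 powr (of_int j * s) * sobolev_decay s' j
    \<le> (4/3) powr s' * (max (2 powr (- s)) (2 powr (s - s'))) ^ nat \<bar>j\<bar>"
proof -
  have eq: "2 powr (real n * a) = (2 powr a) ^ n" for a :: real and n
    by (simp add: powr_realpow[symmetric] powr_powr mult.commute)
  show ?thesis
  proof (cases "j \<ge> 0")
    case True
    have "2 powr (of_int j * s) * sobolev_decay s' j = (4/3) powr s' * 2 powr (real (nat \<bar>j\<bar>) * (s - s'))"
      using True by (simp add: sobolev_decay_def powr_add[symmetric] algebra_simps)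
    also have "\<dots> \<le> (4/3) powr s' * (max (2 powr (- s)) (2 powr (s - s'))) ^ nat \<bar>j\<bar>"
      unfolding eq by (intro mult_left_mono power_mono) auto
    finally show ?thesis .
  next
    case False
    have "2 powr (of_int j * s) * sobolev_decay s' j = (4/3) powr s' * 2 powr (real (nat \<bar>j\<bar>) * (- s))"
      using False by (simp add: sobolev_decay_def)
    also have "\<dots> \<le> (4/3) powr s' * (max (2 powr (- s)) (2 powr (s - s'))) ^ nat \<bar>j\<bar>"
      unfolding eq by (intro mult_left_mono power_mono) auto
    finally show ?thesis .
  qed
qed

theorem theorem2p3:
  fixes s s' :: real
  assumes "s' > 0" and "0 < s" and "s < s'"
  shows "\<exists>C>0. \<forall>h>0. \<forall>\<phi>. dyadic_partition h \<phi> \<longrightarrow>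
           (\<forall>v\<in>sobolev_space s'.
              besov_norm h \<phi> s (truncation h v) \<le> ennreal (C * sobolev_norm s' v))"
proof -
  \<comment> \<open>The common ratio; it is below 1 exactly because \<open>0 < s\<close> and
    \<open>s < s'\<close>.\<close>
  define q where "q = max (2 powr (- s)) (2 powr (s - s'))"
  have q: "0 < q" "q < 1"
    using assms by (auto simp: q_def less_max_iff_disj powr_less_one)
  \<comment> \<open>\<open>(4/3) powr s'\<close> comes from \<open>sobolev_decay\<close> and
    \<open>2 / (1 - q)\<close> from the two-sided geometric sum; neither involves \<open>h\<close>,
    the partition or \<open>v\<close>.\<close>
  define C where "C = (4/3) powr s' * (2 / (1 - q))"
  have C: "C > 0"
    using q by (simp add: C_def)
  have "besov_norm h \<phi> s (truncation h v) \<le> ennreal (C * sobolev_norm s' v)"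
    if h: "h > 0" and \<phi>: "dyadic_partition h \<phi>" and v: "v \<in> sobolev_space s'" for h \<phi> v
  proof -
    let ?g = "fourier_L2 v"
    let ?M = "lebesgue_on (freq_interval h)"
    let ?S = "sobolev_norm s' v"
    have S: "?S \<ge> 0"
      by (simp add: sobolev_norm_def L2_norm_def)
    have w: "(\<lambda>\<xi>. of_real ((1 + \<xi>\<^sup>2) powr (s' / 2)) * ?g \<xi>) \<in> L2_space lebesgue"
      using v by (simp add: sobolev_space_def sobolev_weighted_def)
    have pos: "1 + \<xi>\<^sup>2 > 0" for \<xi> :: real
      by (simp add: add_pos_nonneg)
    have weight: "(\<lambda>\<xi>::real. complex_of_real ((1 + \<xi>\<^sup>2) powr (- s' / 2))) \<in> borel_measurable lebesgue"
      by (rule measurable_completion) measurable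
    \<comment> \<open>Sobolev membership concerns the transform only in weighted form; dividing by
      the positive weight carries measurability over to \<open>fourier_L2 v\<close> itself.\<close>
    have "?g = (\<lambda>\<xi>. of_real ((1 + \<xi>\<^sup>2) powr (- s' / 2)) * (of_real ((1 + \<xi>\<^sup>2) powr (s' / 2)) * ?g \<xi>))"
    proof
      fix \<xi>
      have "(1 + \<xi>\<^sup>2) powr (- s' / 2) * (1 + \<xi>\<^sup>2) powr (s' / 2) = 1"
        using pos[of \<xi>] by (simp add: powr_add[symmetric])
      then show "?g \<xi> = of_real ((1 + \<xi>\<^sup>2) powr (- s' / 2)) * (of_real ((1 + \<xi>\<^sup>2) powr (s' / 2)) * ?g \<xi>)"
        by (metis mult.assoc mult_1 of_real_1 of_real_mult)
    qed
    then have g: "?g \<in> borel_measurable lebesgue"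
      using borel_measurable_times[OF weight L2_spaceD(1)[OF w]] by simp
    have gL2: "?g \<in> L2_space ?M"
    proof (rule L2_space_bound)
      show "?g \<in> borel_measurable ?M"
        using g by (rule measurable_restrict_space1)
      show "integrable ?M (\<lambda>\<xi>. (cmod (of_real ((1 + \<xi>\<^sup>2) powr (s' / 2)) * ?g \<xi>))\<^sup>2)"
        using integrable_mult_indicator[OF freq_interval_sets L2_spaceD(2)[OF w]]
        by (subst integrable_restrict_space) auto
      fix \<xi> :: real
      \<comment> \<open>The weight is at least 1, so the weighted transform dominates the plain
        one.\<close>
      have "1 * cmod (?g \<xi>) \<le> (1 + \<xi>\<^sup>2) powr (s' / 2) * cmod (?g \<xi>)"
        using assms by (intro mult_right_mono ge_one_powr_ge_zero) auto
      then show "(cmod (?g \<xi>))\<^sup>2 \<le> (cmod (of_real ((1 + \<xi>\<^sup>2) powr (s' / 2)) * ?g \<xi>))\<^sup>2"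
        by (intro power_mono) (auto simp: norm_mult)
    qed
    have term_le: "ennreal (2 powr (of_int j * s)) * l2h_norm h (localization h \<phi> j (truncation h v))
        \<le> ennreal ((4/3) powr s' * q ^ nat \<bar>j\<bar> * ?S)" for j
    proof -
      have "localization h \<phi> j (truncation h v) = inv_dft h (\<lambda>\<xi>. ?g \<xi> * of_real (\<phi> j \<xi>))"
        unfolding truncation_def using \<phi>
        by (intro localization_inv_dft h gL2) (simp add: dyadic_partition_def)
      then have "l2h_norm h (localization h \<phi> j (truncation h v))
          \<le> ennreal (L2_norm ?M (\<lambda>\<xi>. ?g \<xi> * of_real (\<phi> j \<xi>)))"
        using l2h_norm_inv_dft_le[OF h L2_norm_localized_le(1)[OF assms(1) h \<phi> g w]] by simp
      also have "\<dots> \<le> ennreal (sobolev_decay s' j * ?S)"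
        using L2_norm_localized_le(2)[OF assms(1) h \<phi> g w]
        by (simp add: ennreal_leI sobolev_norm_def sobolev_weighted_def)
      finally have "ennreal (2 powr (of_int j * s)) * l2h_norm h (localization h \<phi> j (truncation h v))
          \<le> ennreal (2 powr (of_int j * s)) * ennreal (sobolev_decay s' j * ?S)"
        by (rule mult_left_mono) simp
      also have "\<dots> = ennreal (2 powr (of_int j * s) * sobolev_decay s' j * ?S)"
        by (simp add: ennreal_mult'[symmetric] mult.assoc)
      also have "\<dots> \<le> ennreal ((4/3) powr s' * q ^ nat \<bar>j\<bar> * ?S)"
        unfolding q_def using assms S
        by (intro ennreal_leI mult_right_mono weighted_sobolev_decay_le) auto
      finally show ?thesis .
    qed
    \<comment> \<open>Every family in \<open>ennreal\<close> is summable, so it suffices to bound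
      the finite partial sums.\<close>
    show ?thesis
      unfolding besov_norm_def
    proof (rule infsum_le_finite_sums)
      fix F :: "int set" assume F: "finite F"
      have "(\<Sum>j\<in>F. ennreal (2 powr (of_int j * s)) * l2h_norm h (localization h \<phi> j (truncation h v)))
          \<le> (\<Sum>j\<in>F. ennreal ((4/3) powr s' * q ^ nat \<bar>j\<bar> * ?S))"
        by (intro sum_mono term_le)
      also have "\<dots> = ennreal ((4/3) powr s' * (\<Sum>j\<in>F. q ^ nat \<bar>j\<bar>) * ?S)"
        using q S by (subst sum_ennreal) (auto simp: sum_distrib_left sum_distrib_right)
      also have "\<dots> \<le> ennreal (C * ?S)"
        unfolding C_def using S
        by (intro ennreal_leI mult_right_mono mult_left_mono sum_int_geometric_le q F) auto
      finally show "(\<Sum>j\<in>F. ennreal (2 powr (of_int j * s)) * l2h_norm h (localization h \<phi> j (truncation h v)))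
          \<le> ennreal (C * ?S)" .
    qed (simp add: nonneg_summable_on_complete)
  qed
  then show ?thesis
    using C by blast
qed

end
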